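(* Let $M=(S,r)$ be a matroid which is $k$-tensor-compatible with the uniform matroid $U_{2,3}$ for each positive integer $k$. Then $M$ is fully modular extendable.
   Context: "Matroid" means a matroid on a finite ground set, written as (ground set, rank function). $U_{2,3}$ is the rank-$2$ uniform matroid on three elements. A matroid $P=(S_1\times S_2,r)$ is a tensor product of $M_1=(S_1,r_1)$ and $M_2=(S_2,r_2)$ if $r(X\times Y)=r_1(X)\cdot r_2(Y)$ for all $X\subseteq S_1$, $Y\subseteq S_2$; the set of all tensor products is denoted $M_1\otimes M_2$. For matroids $M,N$ let $T_1(M,N)=M\otimes N$ and $T_k(M,N)=\bigcup_{M'\in T_{k-1}(M,N)}M'\otimes N$ for $k\ge 2$. $M$ is $k$-tensor-compatible with $N$ if $T_k(M,N)\neq\emptyset$. For a matroid $M=(S,r)$ and $A,B\subseteq S$, a one-step extension of $M$ with respect to $A$ and $B$ is a matroid $M'=(S',r')$ with $S\subseteq S'$, $r'(X)=r(X)$ for all $X\subseteq S$, for which there is $Z\subseteq S'$ with $r'(A\cup Z)=r(A)$, $r'(B\cup Z)=r(B)$ and $r'(Z)=r(A)+r(B)-r(A\cup B)$. Every matroid is $0$-modular extendable. For $k\ge 1$, $M$ is $k$-modular extendable if for all $A,B\subseteq S$ there is a one-step extension of $M$ with respect to $A$ and $B$ that is $(k-1)$-modular extendable. $M$ is fully modular extendable if it is $k$-modular extendable for every positive integer $k$. *)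

theory Defs
  imports Main
begin

text \<open>
  The tensor product changes the ground set from \<open>S\<close> to \<open>S \<times> E\<close>, and an extension enlarges it.
  Iterating either operation within one HOL type needs a type closed under pairing that never runs
  out of fresh elements. The type \<open>'a elt\<close> of finite binary trees with leaves in \<open>'a\<close> serves as this
  universe: \<open>Tup x y\<close> plays the role of the ordered pair \<open>(x, y)\<close>. A matroid on any type \<open>'a\<close> is
  a matroid on \<open>'a elt\<close> via \<open>Atom\<close>, and since \<open>'a elt\<close> is infinite, every finite extension of
  a finite ground set \<open>S \<subseteq> 'a elt\<close> has, up to an isomorphism fixing \<open>S\<close>, its ground set in \<open>'a elt\<close>.
\<close>

datatype 'a elt = Atom 'a | Tup "'a elt" "'a elt"

lemma infinite_elt: "infinite (UNIV :: 'a elt set)"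
proof
  assume "finite (UNIV :: 'a elt set)"
  moreover have "inj (\<lambda>x :: 'a elt. Tup x x)"
    by (simp add: inj_def)
  ultimately have "surj (\<lambda>x :: 'a elt. Tup x x)"
    by (simp add: finite_UNIV_inj_surj)
  then obtain x :: "'a elt" where "Atom undefined = Tup x x"
    by (metis surjD)
  then show False
    by simp
qed

definition prod_set :: "'a elt set \<Rightarrow> 'a elt set \<Rightarrow> 'a elt set" (infixr \<open>\<times>\<^sub>e\<close> 80)
  where "X \<times>\<^sub>e Y = {Tup x y | x y. x \<in> X \<and> y \<in> Y}"

text \<open>
  A pair of a ground set and a rank function. The rank function is total, as always in HOL; its
  values on sets not contained in the ground set are irrelevant.
\<close>

type_synonym 'b matroid = "'b set \<times> ('b set \<Rightarrow> nat)"

abbreviation ground :: "'b matroid \<Rightarrow> 'b set"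
  where "ground \<equiv> fst"

abbreviation rk :: "'b matroid \<Rightarrow> 'b set \<Rightarrow> nat"
  where "rk \<equiv> snd"

definition is_matroid :: "'b matroid \<Rightarrow> bool"
  where "is_matroid M \<longleftrightarrow>
    finite (ground M) \<and>
    (\<forall>X \<subseteq> ground M. rk M X \<le> card X) \<and>
    (\<forall>X Y. X \<subseteq> Y \<and> Y \<subseteq> ground M \<longrightarrow> rk M X \<le> rk M Y) \<and>
    (\<forall>X Y. X \<subseteq> ground M \<and> Y \<subseteq> ground M \<longrightarrow>
      rk M (X \<union> Y) + rk M (X \<inter> Y) \<le> rk M X + rk M Y)"

text \<open>The uniform matroid \<open>U\<^bsub>n,|E|\<^esub>\<close> on the ground set \<open>E\<close>.\<close>

definition uniform :: "nat \<Rightarrow> 'b set \<Rightarrow> 'b matroid"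
  where "uniform n E = (E, \<lambda>X. min n (card X))"

definition tensor_products :: "'a elt matroid \<Rightarrow> 'a elt matroid \<Rightarrow> 'a elt matroid set"
    (infixl \<open>\<otimes>\<^sub>m\<close> 75)
  where "M \<otimes>\<^sub>m N = {P. is_matroid P \<and> ground P = ground M \<times>\<^sub>e ground N \<and>
    (\<forall>X Y. X \<subseteq> ground M \<and> Y \<subseteq> ground N \<longrightarrow> rk P (X \<times>\<^sub>e Y) = rk M X * rk N Y)}"

text \<open>The recursion starts at \<open>0\<close> with \<open>{M}\<close>, which yields \<open>M \<otimes>\<^sub>m N\<close> at \<open>1\<close>.\<close>

primrec iter_tensor :: "nat \<Rightarrow> 'a elt matroid \<Rightarrow> 'a elt matroid \<Rightarrow> 'a elt matroid set"
  where
    "iter_tensor 0 M N = {M}"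
  | "iter_tensor (Suc k) M N = (\<Union>M' \<in> iter_tensor k M N. M' \<otimes>\<^sub>m N)"

lemma iter_tensor_1: "iter_tensor 1 M N = M \<otimes>\<^sub>m N"
  by simp

definition tensor_compatible :: "nat \<Rightarrow> 'a elt matroid \<Rightarrow> 'a elt matroid \<Rightarrow> bool"
  where "tensor_compatible k M N \<longleftrightarrow> iter_tensor k M N \<noteq> {}"

text \<open>
  The rank condition on \<open>Z\<close>, \<open>r'(Z) = r(A) + r(B) - r(A \<union> B)\<close>, is written without
  subtraction on \<open>nat\<close>.
\<close>

definition one_step_extension :: "'b matroid \<Rightarrow> 'b set \<Rightarrow> 'b set \<Rightarrow> 'b matroid \<Rightarrow> bool"
  where "one_step_extension M A B M' \<longleftrightarrow>
    is_matroid M' \<and> ground M \<subseteq> ground M' \<and>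
    (\<forall>X \<subseteq> ground M. rk M' X = rk M X) \<and>
    (\<exists>Z \<subseteq> ground M'.
      rk M' (A \<union> Z) = rk M A \<and>
      rk M' (B \<union> Z) = rk M B \<and>
      rk M' Z + rk M (A \<union> B) = rk M A + rk M B)"

primrec modular_extendable :: "nat \<Rightarrow> 'a elt matroid \<Rightarrow> bool"
  where
    "modular_extendable 0 M \<longleftrightarrow> is_matroid M"
  | "modular_extendable (Suc k) M \<longleftrightarrow>
      is_matroid M \<and>
      (\<forall>A B. A \<subseteq> ground M \<and> B \<subseteq> ground M \<longrightarrow>
        (\<exists>M'. one_step_extension M A B M' \<and> modular_extendable k M'))"

definition fully_modular_extendable :: "'a elt matroid \<Rightarrow> bool"
  where "fully_modular_extendable M \<longleftrightarrow> (\<forall>k \<ge> 1. modular_extendable k M)"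

end

theory Submission
  imports Defs
begin

text \<open>
  Let \<open>P\<close> be a tensor product of \<open>M = (S, r)\<close> with the uniform matroid of rank \<open>2\<close> on
  \<open>{a, b, c}\<close>, and let \<open>A, B \<subseteq> S\<close>. A one-step extension of \<open>M\<close> is a minor of \<open>P\<close>.
  For vectors this is a computation in \<open>V \<oplus> V\<close>, where
  \<open>a\<close>, \<open>b\<close>, \<open>c\<close> send \<open>v\<close> to \<open>(v, 0)\<close>, \<open>(0, v)\<close>, \<open>(v, v)\<close>.
  Choose \<open>B' \<subseteq> B\<close> as a basis of \<open>B\<close> in the contraction \<open>M / A\<close>, and contract
  \<open>A \<times> {b} \<union> B' \<times> {c}\<close>. Each \<open>\<beta> \<in> B\<close> is congruent modulo the span of \<open>B'\<close> to some \<open>\<alpha>\<close>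
  in the span of \<open>A\<close>, so \<open>(\<beta>, \<beta>)\<close> becomes \<open>(\<alpha>, \<alpha>)\<close> and then \<open>(\<alpha>, 0)\<close>, where \<open>\<alpha>\<close>
  lies in the intersection of the spans of \<open>A\<close> and \<open>B\<close>. Thus \<open>S \<times> {a}\<close> remains a copy of \<open>M\<close>,
  while \<open>B \<times> {c}\<close> becomes a set \<open>Z\<close> spanning this intersection. The same conclusion holds for an
  arbitrary tensor product, since every rank involved is forced by submodularity
  (\<open>one_step_extension_from_tensor\<close>).

  A minor of a matroid that is \<open>k\<close>-tensor-compatible with \<open>N\<close> is again \<open>k\<close>-tensor-compatible with
  \<open>N\<close>: contracting \<open>C\<close> in \<open>M\<close> corresponds to contracting \<open>C \<times> E\<close> in a tensor product
  (\<open>pullback_minor_tensor\<close>). Since \<open>P\<close> can be chosen \<open>(k - 1)\<close>-tensor-compatible if \<open>M\<close> is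
  \<open>k\<close>-tensor-compatible, the extension obtained from \<open>P\<close> inherits this property, and induction
  on \<open>k\<close> gives the result.
\<close>

section \<open>Rank functions\<close>

lemma matroid_finite: "is_matroid M \<Longrightarrow> finite (ground M)"
  by (simp add: is_matroid_def)

lemma rk_le_card: "is_matroid M \<Longrightarrow> X \<subseteq> ground M \<Longrightarrow> rk M X \<le> card X"
  by (simp add: is_matroid_def)

lemma rk_mono: "is_matroid M \<Longrightarrow> X \<subseteq> Y \<Longrightarrow> Y \<subseteq> ground M \<Longrightarrow> rk M X \<le> rk M Y"
  by (simp add: is_matroid_def)

text \<open>
  Submodularity combined with monotonicity: it is applied below to products of sets, where exact
  unions and intersections would be awkward and inclusions suffice.
\<close>

lemma rk_submodular:
  assumes M: "is_matroid M" and "X \<subseteq> ground M" "Y \<subseteq> ground M"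
    and "U \<subseteq> X \<union> Y" and "I \<subseteq> X" "I \<subseteq> Y"
  shows "rk M U + rk M I \<le> rk M X + rk M Y"
proof -
  have "rk M U \<le> rk M (X \<union> Y)"
    by (rule rk_mono[OF M]) (use assms in auto)
  moreover have "rk M I \<le> rk M (X \<inter> Y)"
    by (rule rk_mono[OF M]) (use assms in auto)
  moreover have "rk M (X \<union> Y) + rk M (X \<inter> Y) \<le> rk M X + rk M Y"
    using assms unfolding is_matroid_def by blast
  ultimately show ?thesis by linarith
qed

lemma rk_empty: "is_matroid M \<Longrightarrow> rk M {} = 0"
  using rk_le_card[of M "{}"] by simp

lemma rk_Un_le:
  assumes "is_matroid M" "X \<subseteq> ground M" "Y \<subseteq> ground M" "U \<subseteq> X \<union> Y"
  shows "rk M U \<le> rk M X + rk M Y"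
  using rk_submodular[OF assms, of "{}"] by simp

text \<open>The set \<open>B'\<close> is a basis of \<open>B\<close> in the contraction of \<open>A\<close>.\<close>

lemma relative_basis_exists:
  assumes M: "is_matroid M" and A: "A \<subseteq> ground M" and B: "B \<subseteq> ground M"
  shows "\<exists>B' \<subseteq> B. rk M (A \<union> B') = rk M (A \<union> B) \<and> rk M A + rk M B' = rk M (A \<union> B)"
proof -
  have "finite B"
    using B matroid_finite[OF M] finite_subset by blast
  then have "\<exists>B' \<subseteq> B. rk M (A \<union> B') = rk M (A \<union> B) \<and> rk M A + card B' = rk M (A \<union> B)"
    using B
  proof (induction B)
    case empty
    then show ?case by simp
  next
    case (insert x B)
    then obtain B' where B': "B' \<subseteq> B" "rk M (A \<union> B') = rk M (A \<union> B)"
      "rk M A + card B' = rk M (A \<union> B)"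
      by auto
    show ?case
    proof (cases "rk M (A \<union> insert x B) = rk M (A \<union> B)")
      case True
      then show ?thesis using B' by auto
    next
      case False
      have "rk M (A \<union> B) \<le> rk M (A \<union> insert x B)"
        by (rule rk_mono[OF M]) (use A insert.prems in auto)
      moreover have "rk M (A \<union> insert x B) \<le> rk M (A \<union> B) + rk M {x}"
        by (rule rk_Un_le[OF M]) (use A insert.prems in auto)
      moreover have "rk M {x} \<le> 1"
        using rk_le_card[OF M, of "{x}"] insert.prems by simp
      ultimately have step: "rk M (A \<union> insert x B) = rk M (A \<union> B) + 1"
        using False by linarith
      have "rk M (A \<union> insert x B) + rk M (A \<union> B') \<le> rk M (A \<union> insert x B') + rk M (A \<union> B)"
        by (rule rk_submodular[OF M]) (use A B' insert.prems in auto)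
      moreover have "rk M (A \<union> insert x B') \<le> rk M (A \<union> insert x B)"
        by (rule rk_mono[OF M]) (use A B' insert.prems in auto)
      ultimately have "rk M (A \<union> insert x B') = rk M (A \<union> insert x B)"
        using B' by linarith
      moreover have "card (insert x B') = card B' + 1"
        using B'(1) insert.hyps finite_subset[OF B'(1)] by (auto simp: card_insert_if)
      ultimately show ?thesis
        using B' step by (intro exI[of _ "insert x B'"]) auto
    qed
  qed
  then obtain B' where B': "B' \<subseteq> B" "rk M (A \<union> B') = rk M (A \<union> B)"
    "rk M A + card B' = rk M (A \<union> B)"
    by auto
  have "rk M (A \<union> B') \<le> rk M A + rk M B'"
    by (rule rk_Un_le[OF M]) (use A B B' in auto)
  moreover have "rk M B' \<le> card B'"
    by (rule rk_le_card[OF M]) (use B B' in auto)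
  ultimately show ?thesis using B' by (intro exI[of _ B']) auto
qed

lemma uniform_is_matroid:
  assumes "finite E"
  shows "is_matroid (uniform n E)"
proof -
  have "min n (card (X \<union> Y)) + min n (card (X \<inter> Y)) \<le> min n (card X) + min n (card Y)"
    if "X \<subseteq> E" "Y \<subseteq> E" for X Y
  proof -
    have fin: "finite X" "finite Y"
      using that assms finite_subset by auto
    then have "card X + card Y = card (X \<union> Y) + card (X \<inter> Y)"
      by (rule card_Un_Int)
    moreover have "card (X \<inter> Y) \<le> card X" "card (X \<inter> Y) \<le> card Y"
      using fin by (auto intro: card_mono)
    ultimately show ?thesis by linarith
  qed
  moreover have "min n (card X) \<le> min n (card Y)" if "X \<subseteq> Y" "Y \<subseteq> E" for X Y
  proof -
    have "card X \<le> card Y"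
      using that assms by (meson card_mono finite_subset)
    then show ?thesis by simp
  qed
  ultimately show ?thesis
    using assms by (auto simp: is_matroid_def uniform_def)
qed

section \<open>Pulling back minors\<close>

text \<open>
  The contraction of \<open>C\<close> in \<open>M\<close>, pulled back along \<open>g\<close>. For an inclusion \<open>g\<close> this is the minor
  of \<open>M\<close> on \<open>T\<close>, where elements of \<open>C \<inter> T\<close> stay as loops instead of being removed; for a bijection
  \<open>g\<close> and \<open>C = {}\<close> it is a relabelling. One construction thus covers restriction, contraction and
  isomorphism.
\<close>

definition pullback_minor :: "('c \<Rightarrow> 'b) \<Rightarrow> 'b set \<Rightarrow> 'c set \<Rightarrow> 'b matroid \<Rightarrow> 'c matroid"
  where "pullback_minor g C T M = (T, \<lambda>X. rk M (g ` X \<union> C) - rk M C)"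

lemma ground_pullback_minor [simp]: "ground (pullback_minor g C T M) = T"
  by (simp add: pullback_minor_def)

lemma rk_pullback_minor: "rk (pullback_minor g C T M) X = rk M (g ` X \<union> C) - rk M C"
  by (simp add: pullback_minor_def)

lemma pullback_minor_is_matroid:
  assumes M: "is_matroid M" and T: "finite T" "g ` T \<subseteq> ground M" and C: "C \<subseteq> ground M"
  shows "is_matroid (pullback_minor g C T M)"
proof -
  have "rk M (g ` X \<union> C) - rk M C \<le> card X" if "X \<subseteq> T" for X
  proof -
    have "g ` X \<subseteq> ground M" using that T by auto
    then have "rk M (g ` X \<union> C) \<le> rk M (g ` X) + rk M C" "rk M (g ` X) \<le> card (g ` X)"
      using rk_Un_le[OF M _ C, of "g ` X"] rk_le_card[OF M] by auto
    moreover have "card (g ` X) \<le> card X"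
      using that T finite_subset card_image_le by blast
    ultimately show ?thesis by linarith
  qed
  moreover have "rk M (g ` X \<union> C) - rk M C \<le> rk M (g ` Y \<union> C) - rk M C"
    if "X \<subseteq> Y" "Y \<subseteq> T" for X Y
    by (rule diff_le_mono, rule rk_mono[OF M]) (use that T C in auto)
  moreover have "(rk M (g ` (X \<union> Y) \<union> C) - rk M C) + (rk M (g ` (X \<inter> Y) \<union> C) - rk M C)
      \<le> (rk M (g ` X \<union> C) - rk M C) + (rk M (g ` Y \<union> C) - rk M C)"
    if X: "X \<subseteq> T" and Y: "Y \<subseteq> T" for X Y
  proof -
    have excess: "\<exists>d. rk M (g ` W \<union> C) = rk M C + d" if "W \<subseteq> T" for W
      by (intro le_Suc_ex rk_mono[OF M]) (use that T C in auto)
    have "rk M (g ` (X \<union> Y) \<union> C) + rk M (g ` (X \<inter> Y) \<union> C) \<le> rk M (g ` X \<union> C) + rk M (g ` Y \<union> C)"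
      by (rule rk_submodular[OF M]) (use X Y T C in auto)
    moreover obtain x y where "rk M (g ` X \<union> C) = rk M C + x" "rk M (g ` Y \<union> C) = rk M C + y"
      using excess[OF X] excess[OF Y] by blast
    moreover obtain u i where "rk M (g ` (X \<union> Y) \<union> C) = rk M C + u"
      "rk M (g ` (X \<inter> Y) \<union> C) = rk M C + i"
      using excess[of "X \<union> Y"] excess[of "X \<inter> Y"] X Y by blast
    ultimately show ?thesis by simp
  qed
  ultimately show ?thesis
    using T(1) unfolding is_matroid_def ground_pullback_minor rk_pullback_minor by blast
qed

section \<open>Minors and tensor products\<close>

lemma tensorD:
  assumes "P \<in> M \<otimes>\<^sub>m N"
  shows "is_matroid P" and "ground P = ground M \<times>\<^sub>e ground N"
    and "\<And>X Y. X \<subseteq> ground M \<Longrightarrow> Y \<subseteq> ground N \<Longrightarrow> rk P (X \<times>\<^sub>e Y) = rk M X * rk N Y"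
  using assms by (auto simp: tensor_products_def)

lemma finite_prod_set: "finite X \<Longrightarrow> finite Y \<Longrightarrow> finite (X \<times>\<^sub>e Y)"
  unfolding prod_set_def by (rule finite_image_set2) auto

text \<open>
  The rank that makes the contraction of \<open>C \<times> ground N\<close> a tensor product of \<open>M / C\<close> with \<open>N\<close>. The upper
  bound is submodularity; for the lower bound, a set \<open>Y'\<close> that complements \<open>Y\<close> in rank
  bounds how much is missing from \<open>X \<times> ground N\<close>.
\<close>

lemma tensor_rank_with_full_fibres:
  assumes N: "is_matroid N" and tens: "P \<in> M \<otimes>\<^sub>m N"
    and CX: "C \<subseteq> X" and X: "X \<subseteq> ground M" and Y: "Y \<subseteq> ground N"
  shows "rk P (X \<times>\<^sub>e Y \<union> C \<times>\<^sub>e ground N) + rk M C * rk N Y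
    = rk M X * rk N Y + rk M C * rk N (ground N)"
proof -
  note P = tensorD[OF tens]
  let ?E = "ground N" and ?U = "X \<times>\<^sub>e Y \<union> C \<times>\<^sub>e ground N"
  have C: "C \<subseteq> ground M" using CX X by auto
  have "rk P ?U + rk P (C \<times>\<^sub>e Y) \<le> rk P (X \<times>\<^sub>e Y) + rk P (C \<times>\<^sub>e ?E)"
    by (rule rk_submodular[OF P(1)]) (use P(2) CX X Y in \<open>auto simp: prod_set_def\<close>)
  then have upper: "rk P ?U + rk M C * rk N Y \<le> rk M X * rk N Y + rk M C * rk N ?E"
    using P(3) C X Y by simp
  obtain Y' where Y': "Y' \<subseteq> ?E" "rk N (Y \<union> Y') = rk N (Y \<union> ?E)"
    "rk N Y + rk N Y' = rk N (Y \<union> ?E)"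
    using relative_basis_exists[OF N Y order_refl] by blast
  have E: "Y \<union> ?E = ?E" using Y by auto
  have "rk P (X \<times>\<^sub>e (Y \<union> Y')) + rk P (C \<times>\<^sub>e Y') \<le> rk P ?U + rk P (X \<times>\<^sub>e Y')"
    by (rule rk_submodular[OF P(1)]) (use P(2) CX X Y Y' in \<open>auto simp: prod_set_def\<close>)
  then have "rk M X * (rk N Y + rk N Y') + rk M C * rk N Y' \<le> rk P ?U + rk M X * rk N Y'"
    using P(3) C X Y Y' E by simp
  moreover have "rk M C * rk N ?E = rk M C * rk N Y + rk M C * rk N Y'"
    using Y'(3) E by (metis distrib_left)
  ultimately show ?thesis
    using upper by (simp add: distrib_left)
qed

fun map_fst_Tup :: "('a elt \<Rightarrow> 'a elt) \<Rightarrow> 'a elt \<Rightarrow> 'a elt"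
  where
    "map_fst_Tup g (Tup x y) = Tup (g x) y"
  | "map_fst_Tup g (Atom x) = Atom x"

lemma map_fst_Tup_image: "map_fst_Tup g ` (X \<times>\<^sub>e Y) = (g ` X) \<times>\<^sub>e Y"
  unfolding prod_set_def by force

text \<open>Taking minors commutes with tensor products, fibrewise in the second factor.\<close>

lemma pullback_minor_tensor:
  assumes M: "is_matroid M" and N: "is_matroid N" and tens: "P \<in> M \<otimes>\<^sub>m N"
    and T: "finite T" "g ` T \<subseteq> ground M" and C: "C \<subseteq> ground M"
  shows "pullback_minor (map_fst_Tup g) (C \<times>\<^sub>e ground N) (T \<times>\<^sub>e ground N) P
    \<in> pullback_minor g C T M \<otimes>\<^sub>m N"
proof -
  note P = tensorD[OF tens]
  let ?E = "ground N"
  let ?Q = "pullback_minor (map_fst_Tup g) (C \<times>\<^sub>e ?E) (T \<times>\<^sub>e ?E) P"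
  have "is_matroid ?Q"
    by (rule pullback_minor_is_matroid[OF P(1)])
      (use P(2) T C matroid_finite[OF N] in
        \<open>auto simp: map_fst_Tup_image finite_prod_set, auto simp: prod_set_def\<close>)
  moreover have "rk ?Q (X \<times>\<^sub>e Y) = rk (pullback_minor g C T M) X * rk N Y"
    if X: "X \<subseteq> T" and Y: "Y \<subseteq> ?E" for X Y
  proof -
    have "(g ` X) \<times>\<^sub>e Y \<union> C \<times>\<^sub>e ?E = (g ` X \<union> C) \<times>\<^sub>e Y \<union> C \<times>\<^sub>e ?E"
      using Y by (auto simp: prod_set_def)
    moreover have "rk P ((g ` X \<union> C) \<times>\<^sub>e Y \<union> C \<times>\<^sub>e ?E) + rk M C * rk N Y
        = rk M (g ` X \<union> C) * rk N Y + rk M C * rk N ?E"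
      by (rule tensor_rank_with_full_fibres[OF N tens]) (use X Y T C in auto)
    moreover have "rk P (C \<times>\<^sub>e ?E) = rk M C * rk N ?E"
      using P(3) C by simp
    moreover have "rk M C * rk N Y \<le> rk M (g ` X \<union> C) * rk N Y"
      by (rule mult_le_mono1, rule rk_mono[OF M]) (use X T C in auto)
    ultimately show ?thesis
      by (simp add: rk_pullback_minor map_fst_Tup_image diff_mult_distrib)
  qed
  ultimately show ?thesis
    by (simp add: tensor_products_def)
qed

text \<open>The iteration appends its last factor; here the first factor is split off instead.\<close>

lemma tensor_compatible_Suc:
  "tensor_compatible (Suc k) M N \<longleftrightarrow> (\<exists>P \<in> M \<otimes>\<^sub>m N. tensor_compatible k P N)"
proof -
  have "iter_tensor (Suc k) M N = (\<Union>P \<in> M \<otimes>\<^sub>m N. iter_tensor k P N)"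
    by (induction k) auto
  then show ?thesis
    unfolding tensor_compatible_def by auto
qed

lemma tensor_compatible_pullback_minor:
  assumes N: "is_matroid N" and "is_matroid M" and "tensor_compatible k M N"
    and "finite T" "g ` T \<subseteq> ground M" "C \<subseteq> ground M"
  shows "tensor_compatible k (pullback_minor g C T M) N"
  using assms(2-)
proof (induction k arbitrary: M g C T)
  case 0
  then show ?case by (simp add: tensor_compatible_def)
next
  case (Suc k)
  then obtain P where P: "P \<in> M \<otimes>\<^sub>m N" "tensor_compatible k P N"
    by (auto simp: tensor_compatible_Suc)
  let ?h = "map_fst_Tup g" and ?D = "C \<times>\<^sub>e ground N" and ?V = "T \<times>\<^sub>e ground N"
  have "tensor_compatible k (pullback_minor ?h ?D ?V P) N"
    by (rule Suc.IH)
      (use tensorD[OF P(1)] P(2) Suc.prems matroid_finite[OF N] in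
        \<open>auto simp: map_fst_Tup_image finite_prod_set, auto simp: prod_set_def\<close>)
  then show ?case
    using pullback_minor_tensor[OF Suc.prems(1) N P(1) Suc.prems(3-5)] tensor_compatible_Suc by blast
qed

section \<open>One-step extensions from tensor products\<close>

text \<open>Two distinct points of the line form a basis, so their fibres are independent of each other.\<close>

lemma tensor_rank_two_fibres:
  assumes tens: "P \<in> M \<otimes>\<^sub>m uniform 2 E"
    and pq: "p \<in> E" "q \<in> E" "p \<noteq> q" and X: "X \<subseteq> ground M" and Y: "Y \<subseteq> ground M"
  shows "rk P (X \<times>\<^sub>e {p} \<union> Y \<times>\<^sub>e {q}) = rk M X + rk M Y"
proof -
  note P = tensorD[OF tens]
  have gP: "ground P = ground M \<times>\<^sub>e E"
    using P(2) by (simp add: uniform_def)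
  have one: "rk P (W \<times>\<^sub>e {e}) = rk M W" if "W \<subseteq> ground M" "e \<in> E" for W e
    using P(3)[OF that(1), of "{e}"] that(2) by (simp add: uniform_def)
  have two: "rk P (W \<times>\<^sub>e {p, q}) = 2 * rk M W" if "W \<subseteq> ground M" for W
    using P(3)[OF that, of "{p, q}"] pq by (simp add: uniform_def)
  let ?W = "X \<union> Y" and ?U = "X \<times>\<^sub>e {p} \<union> Y \<times>\<^sub>e {q}"
  have "rk P ?U \<le> rk P (X \<times>\<^sub>e {p}) + rk P (Y \<times>\<^sub>e {q})"
    by (rule rk_Un_le[OF P(1)]) (use gP pq X Y in \<open>auto simp: prod_set_def\<close>)
  moreover have "rk P (?W \<times>\<^sub>e {p} \<union> Y \<times>\<^sub>e {q}) + rk P (X \<times>\<^sub>e {p}) \<le> rk P ?U + rk P (?W \<times>\<^sub>e {p})"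
    by (rule rk_submodular[OF P(1)]) (use gP pq X Y in \<open>auto simp: prod_set_def\<close>)
  moreover have "rk P (?W \<times>\<^sub>e {p, q}) + rk P (Y \<times>\<^sub>e {q})
      \<le> rk P (?W \<times>\<^sub>e {p} \<union> Y \<times>\<^sub>e {q}) + rk P (?W \<times>\<^sub>e {q})"
    by (rule rk_submodular[OF P(1)]) (use gP pq X Y in \<open>auto simp: prod_set_def\<close>)
  ultimately show ?thesis
    using one two X Y pq by (simp add: le_antisym)
qed

text \<open>
  Modulo the fibre \<open>S \<times> {a}\<close> the other two fibres become parallel: any two points of the line span
  the third. If \<open>A\<close> and \<open>B\<close> are skew in \<open>M\<close>, it follows that the whole fibre \<open>S \<times> {a}\<close> is skew to
  \<open>A \<times> {b} \<union> B \<times> {c}\<close>, so that contracting the latter leaves a copy of \<open>M\<close>.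
\<close>

lemma tensor_rank_skew_to_fibre:
  assumes tens: "P \<in> M \<otimes>\<^sub>m uniform 2 {a, b, c}" and abc: "a \<noteq> b" "a \<noteq> c" "b \<noteq> c"
    and A: "A \<subseteq> ground M" and B: "B \<subseteq> ground M" and skew: "rk M A + rk M B = rk M (A \<union> B)"
    and X: "X \<subseteq> ground M"
  shows "rk P (X \<times>\<^sub>e {a} \<union> (A \<times>\<^sub>e {b} \<union> B \<times>\<^sub>e {c})) = rk M X + rk M (A \<union> B)"
proof -
  note P = tensorD[OF tens]
  let ?E = "{a, b, c}" and ?S = "ground M"
  have gP: "ground P = ?S \<times>\<^sub>e ?E"
    using P(2) by (simp add: uniform_def)
  have one: "rk P (W \<times>\<^sub>e {e}) = rk M W" if "W \<subseteq> ?S" "e \<in> ?E" for W e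
    using P(3)[OF that(1), of "{e}"] that(2) by (simp add: uniform_def)
  have two: "rk P (W \<times>\<^sub>e {e, f}) = 2 * rk M W" if "W \<subseteq> ?S" "e \<in> ?E" "f \<in> ?E" "e \<noteq> f" for W e f
    using P(3)[OF that(1), of "{e, f}"] that(2-) by (simp add: uniform_def)
  have three: "rk P (W \<times>\<^sub>e ?E) = 2 * rk M W" if "W \<subseteq> ?S" for W
    using P(3)[OF that, of ?E] abc by (simp add: uniform_def)
  let ?C = "A \<times>\<^sub>e {b} \<union> B \<times>\<^sub>e {c}"
  let ?D = "?S \<times>\<^sub>e {a} \<union> ?C"
  have rkC: "rk P ?C = rk M (A \<union> B)"
    using tensor_rank_two_fibres[OF tens _ _ abc(3) A B] skew by simp
  \<comment> \<open>The set \<open>?D\<close> spans all three copies of \<open>A\<close> and of \<open>B\<close>.\<close>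
  have "rk P (?D \<union> A \<times>\<^sub>e ?E) + rk P (A \<times>\<^sub>e {a, b}) \<le> rk P ?D + rk P (A \<times>\<^sub>e ?E)"
    by (rule rk_submodular[OF P(1)]) (use gP A B in \<open>auto simp: prod_set_def\<close>)
  moreover have "rk P (?S \<times>\<^sub>e {a} \<union> (A \<union> B) \<times>\<^sub>e {b}) + rk P (B \<times>\<^sub>e {a, c})
      \<le> rk P (?D \<union> A \<times>\<^sub>e ?E) + rk P (B \<times>\<^sub>e ?E)"
    by (rule rk_submodular[OF P(1)]) (use gP A B in \<open>auto simp: prod_set_def\<close>)
  moreover have "rk P (?S \<times>\<^sub>e {a} \<union> (A \<union> B) \<times>\<^sub>e {b}) = rk M ?S + rk M (A \<union> B)"
    by (rule tensor_rank_two_fibres[OF tens _ _ abc(1)]) (use A B in auto)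
  ultimately have "rk M ?S + rk M (A \<union> B) \<le> rk P ?D"
    using two[OF A] two[OF B] three[OF A] three[OF B] abc by simp
  moreover have "rk P ?D + rk P (X \<times>\<^sub>e {a}) \<le> rk P (X \<times>\<^sub>e {a} \<union> ?C) + rk P (?S \<times>\<^sub>e {a})"
    by (rule rk_submodular[OF P(1)]) (use gP A B X in \<open>auto simp: prod_set_def\<close>)
  moreover have "rk P (X \<times>\<^sub>e {a} \<union> ?C) \<le> rk P (X \<times>\<^sub>e {a}) + rk P ?C"
    by (rule rk_Un_le[OF P(1)]) (use gP A B X in \<open>auto simp: prod_set_def\<close>)
  ultimately show ?thesis
    using one[OF X, of a] one[OF order_refl, of a] rkC by simp
qed

text \<open>The vector computation of the introduction, carried out with ranks.\<close>

lemma one_step_extension_from_tensor: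
  fixes M :: "'a elt matroid"
  assumes M: "is_matroid M" and tens: "P \<in> M \<otimes>\<^sub>m uniform 2 E" and E: "card E = 3"
    and A: "A \<subseteq> ground M" and B: "B \<subseteq> ground M"
  shows "\<exists>(g :: 'a elt \<Rightarrow> 'a elt) C T. finite T \<and> g ` T \<subseteq> ground P \<and> C \<subseteq> ground P \<and>
    one_step_extension M A B (pullback_minor g C T P)"
proof -
  note P = tensorD[OF tens]
  let ?S = "ground M"
  obtain a b c where Eabc: "E = {a, b, c}" and abc: "a \<noteq> b" "a \<noteq> c" "b \<noteq> c"
    using E by (auto simp: card_3_iff)
  note tens' = tens[unfolded Eabc]
  have gP: "ground P = ?S \<times>\<^sub>e {a, b, c}"
    using P(2) by (simp add: uniform_def Eabc)
  have one: "rk P (W \<times>\<^sub>e {e}) = rk M W" if "W \<subseteq> ?S" "e \<in> {a, b, c}" for W e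
    using P(3)[OF that(1), of "{e}"] that(2) by (simp add: uniform_def Eabc)
  have three: "rk P (W \<times>\<^sub>e {a, b, c}) = 2 * rk M W" if "W \<subseteq> ?S" for W
    using P(3)[OF that, of "{a, b, c}"] abc by (simp add: uniform_def Eabc)
  obtain B' where B': "B' \<subseteq> B" "rk M (A \<union> B') = rk M (A \<union> B)" "rk M A + rk M B' = rk M (A \<union> B)"
    using relative_basis_exists[OF M A B] by blast
  have B'S: "B' \<subseteq> ?S" using B' B by auto
  define C where "C = A \<times>\<^sub>e {b} \<union> B' \<times>\<^sub>e {c}"
  have C: "C \<subseteq> ground P"
    using A B'S by (auto simp: C_def gP prod_set_def)
  have rkC: "rk P C = rk M (A \<union> B)"
    using tensor_rank_two_fibres[OF tens' _ _ abc(3) A B'S] B' by (simp add: C_def)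
  \<comment> \<open>Relabelling: \<open>S\<close> itself stands for \<open>S \<times> {a}\<close>, and a fresh copy \<open>Z\<close> of \<open>B\<close> for \<open>B \<times> {c}\<close>.\<close>
  have finS: "finite ?S" and finB: "finite B"
    using matroid_finite[OF M] B finite_subset by auto
  have "infinite (UNIV - ?S)"
    using infinite_elt finS by (rule Diff_infinite_finite[rotated])
  then obtain Z where Z: "finite Z" "card Z = card B" "Z \<subseteq> UNIV - ?S"
    using infinite_arbitrarily_large by blast
  then obtain h where "bij_betw h Z B"
    using finite_same_card_bij[OF Z(1) finB] by auto
  then have h: "h ` Z = B"
    by (simp add: bij_betw_def)
  define g where "g x = (if x \<in> ?S then Tup x a else Tup (h x) c)" for x
  have gS: "g ` X = X \<times>\<^sub>e {a}" if "X \<subseteq> ?S" for X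
    using that by (auto simp: g_def prod_set_def)
  have "g ` Z = (\<lambda>z. Tup (h z) c) ` Z"
    using Z(3) by (intro image_cong) (auto simp: g_def)
  also have "\<dots> = B \<times>\<^sub>e {c}"
    using h by (auto simp: prod_set_def)
  finally have gZ: "g ` Z = B \<times>\<^sub>e {c}" .
  define T where "T = ?S \<union> Z"
  have T: "finite T" "g ` T \<subseteq> ground P"
    using finS Z(1) B gS[OF order_refl] by (auto simp: T_def image_Un gZ gP prod_set_def)
  let ?M' = "pullback_minor g C T P"
  have M': "is_matroid ?M'"
    by (rule pullback_minor_is_matroid[OF P(1) T C])
  have ext: "rk ?M' X = rk M X" if X: "X \<subseteq> ?S" for X
    using tensor_rank_skew_to_fibre[OF tens' abc A B'S _ X] B' rkC
    by (simp add: rk_pullback_minor gS[OF X] C_def)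
  have "rk P (g ` (A \<union> Z) \<union> C) + rk P (A \<times>\<^sub>e {c}) \<le> rk P (A \<times>\<^sub>e {a, b, c}) + rk P ((A \<union> B) \<times>\<^sub>e {c})"
    by (rule rk_submodular[OF P(1)])
      (use A B B' in \<open>auto simp: image_Un gS gZ gP C_def prod_set_def\<close>)
  then have "rk ?M' (A \<union> Z) \<le> rk M A"
    using one[of A c] one[of "A \<union> B" c] three[OF A] A B rkC by (simp add: rk_pullback_minor)
  moreover have "rk ?M' A \<le> rk ?M' (A \<union> Z)"
    by (rule rk_mono[OF M']) (use A in \<open>auto simp: T_def\<close>)
  ultimately have AZ: "rk ?M' (A \<union> Z) = rk M A"
    using ext[OF A] by simp
  have "rk P (g ` (B \<union> Z) \<union> C) + rk P (B \<times>\<^sub>e {b}) \<le> rk P (B \<times>\<^sub>e {a, b, c}) + rk P ((A \<union> B) \<times>\<^sub>e {b})"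
    by (rule rk_submodular[OF P(1)])
      (use A B B' in \<open>auto simp: image_Un gS gZ gP C_def prod_set_def\<close>)
  then have "rk ?M' (B \<union> Z) \<le> rk M B"
    using one[of B b] one[of "A \<union> B" b] three[OF B] A B rkC by (simp add: rk_pullback_minor)
  moreover have "rk ?M' B \<le> rk ?M' (B \<union> Z)"
    by (rule rk_mono[OF M']) (use B in \<open>auto simp: T_def\<close>)
  ultimately have BZ: "rk ?M' (B \<union> Z) = rk M B"
    using ext[OF B] by simp
  have "g ` Z \<union> C = A \<times>\<^sub>e {b} \<union> B \<times>\<^sub>e {c}"
    using B' by (auto simp: gZ C_def prod_set_def)
  then have "rk P (g ` Z \<union> C) = rk M A + rk M B"
    using tensor_rank_two_fibres[OF tens' _ _ abc(3) A B] by simp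
  moreover have "rk M (A \<union> B) \<le> rk M A + rk M B"
    by (rule rk_Un_le[OF M A B]) simp
  ultimately have "rk ?M' Z + rk M (A \<union> B) = rk M A + rk M B"
    using rkC by (simp add: rk_pullback_minor)
  then have "one_step_extension M A B ?M'"
    unfolding one_step_extension_def using M' ext AZ BZ
    by (auto simp: T_def intro!: exI[of _ Z])
  then show ?thesis using T C by blast
qed

section \<open>Full modular extendability\<close>

lemma tensor_compatible_imp_modular_extendable:
  assumes E: "card E = 3" and "is_matroid M" and "tensor_compatible k M (uniform 2 E)"
  shows "modular_extendable k M"
  using assms(2-)
proof (induction k arbitrary: M)
  case 0
  then show ?case by simp
next
  case (Suc k)
  have N: "is_matroid (uniform 2 E)"
    using E by (intro uniform_is_matroid) (simp add: card_ge_0_finite)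
  obtain P where P: "P \<in> M \<otimes>\<^sub>m uniform 2 E" "tensor_compatible k P (uniform 2 E)"
    using Suc.prems by (auto simp: tensor_compatible_Suc)
  have "\<exists>M'. one_step_extension M A B M' \<and> modular_extendable k M'"
    if AB: "A \<subseteq> ground M" "B \<subseteq> ground M" for A B
  proof -
    obtain g :: "'a elt \<Rightarrow> 'a elt" and C T
      where gCT: "finite T" "g ` T \<subseteq> ground P" "C \<subseteq> ground P"
        and ext: "one_step_extension M A B (pullback_minor g C T P)"
      using one_step_extension_from_tensor[OF Suc.prems(1) P(1) E AB] by blast
    have "tensor_compatible k (pullback_minor g C T P) (uniform 2 E)"
      by (rule tensor_compatible_pullback_minor[OF N tensorD(1)[OF P(1)] P(2) gCT])
    then have "modular_extendable k (pullback_minor g C T P)"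
      using Suc.IH ext by (simp add: one_step_extension_def)
    then show ?thesis using ext by blast
  qed
  then show ?case using Suc.prems(1) by simp
qed

theorem corollary5p6:
  fixes M :: "'a elt matroid" and E :: "'a elt set"
  assumes "is_matroid M"
    and "card E = 3"
    and "\<And>k. k \<ge> 1 \<Longrightarrow> tensor_compatible k M (uniform 2 E)"
  shows "fully_modular_extendable M"
  using tensor_compatible_imp_modular_extendable[OF assms(2,1)] assms(3)
  by (simp add: fully_modular_extendable_def)

end
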